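(* Let $u\in\Lambda$ with $R^s_u\neq\emptyset$. Let $(h,\beta)\in\Gamma^{\mathrm{dec}}_{\mathrm{ev}}(u)$ be usefully decreasing for $u$. Then $$\max_{n\in\mathbb N}u_n=\max\Big\{u_n: n=0,\dots,\mathfrak m(h,\beta),\dots,\min_{k\in\mathcal S(u,h)\cap[\mathfrak m(h,\beta),+\infty)}\lfloor\mathfrak F_u(k,h,\beta)\rfloor\Big\}.$$ If, finally, $(h,\beta)\in\Gamma^{\mathrm{cst}}_{\mathrm{ev}}(u)$ with $\mathfrak c(h,\beta)=0$, then $$\max_{n\in\mathbb N}u_n=\max\{u_n: n=0,\dots,\lfloor\mathfrak F_u(K^s_u,h,\beta)\rfloor\}.$$
   Context: $\mathbb N=\{0,1,2,\dots\}$. $\Lambda$ is the set of real sequences $u=(u_k)_{k\in\mathbb N}$ with $\sup_n u_n<+\infty$. $R^s_u:=\{k\in\mathbb N: u_k>\limsup_{n\to+\infty}u_n\}$, $\Delta^s_u:=\{k\in\mathbb N:\max_{0\le j\le k}u_j>\sup_{j>k}u_j\}$, $K^s_u:=\inf\Delta^s_u$ (for $u\in\Lambda$, $\Delta^s_u\neq\emptyset$ if and only if $R^s_u\ne\emptyset$). $\Omega([0,1])$ is the set of functions $f:\mathbb R\to\mathbb R$ strictly increasing and continuous on $[0,1]$; $f^{-1}:[f(0),f(1)]\to[0,1]$ denotes the inverse of $f$ restricted to $[0,1]$. $\Gamma(u):=\{(h,\beta)\in\Omega([0,1])^{\mathbb N}\times(0,1)^{\mathbb N}: u_k\le h_k(\beta_k^k)\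 \forall k\in\mathbb N\}$, where $\beta_k^k$ is the $k$-th power of $\beta_k$. For $f,g\in\Omega([0,1])$, $f\le g$ means $f(x)\le g(x)$ for all $x\in[0,1]$; $(f,\beta)\le(g,\gamma)$ means $f\le g$ and $\beta\le\gamma$. $\Gamma^{\mathrm{dec}}_{\mathrm{ev}}(u)$ is the set of $(h,\beta)\in\Gamma(u)$ for which there is $N\in\mathbb N$ with $(h_{n+1},\beta_{n+1})\le(h_n,\beta_n)$ for all $n\ge N$; $\mathfrak m(h,\beta)$ is the smallest such $N$. $\Gamma^{\mathrm{cst}}_{\mathrm{ev}}(u)$ is the set of $(h,\beta)\in\Gamma(u)$ for which the sequence $((h_n,\beta_n))_n$ is constant from some index on; $\mathfrak c(h,\beta)$ is the smallest index from which it is constant. $\mathcal S(u,h):=\{k\in\mathbb N: u_k>h_k(0)\}$. $(h,\beta)\in\Gamma^{\mathrm{dec}}_{\mathrm{ev}}(u)$ is usefully decreasing (for $u$) if $\mathcal S(u,h)\cap[\mathfrak m(h,\beta),+\infty)\neq\emptyset$. The upper bound functional is $\mathfrak F_u(k,h,\beta):=\ln(h_k^{-1}(u_k))/\ln(\beta_k)$ if $(h,\beta)\in\Gamma(u)$ and $u_k>h_k(0)$, and $+\infty$ otherwise. $\lfloor\cdot\rfloor$ is the floor function. *)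

theory Defs
  imports Complex_Main "HOL-Library.Extended_Real"
begin

definition is_maximum :: "'a::order set \<Rightarrow> 'a \<Rightarrow> bool" where
  "is_maximum A x \<longleftrightarrow> x \<in> A \<and> (\<forall>y\<in>A. y \<le> x)"

definition is_minimum :: "'a::order set \<Rightarrow> 'a \<Rightarrow> bool" where
  "is_minimum A x \<longleftrightarrow> x \<in> A \<and> (\<forall>y\<in>A. x \<le> y)"

definition Lam :: "(nat \<Rightarrow> real) set" where
  "Lam = {u. bdd_above (range u)}"

(* The limsup of a sequence in Lam may be -\<infinity>, hence the embedding into ereal. *)
definition Rs :: "(nat \<Rightarrow> real) \<Rightarrow> nat set" where
  "Rs u = {k. ereal (u k) > limsup (\<lambda>n. ereal (u n))}"

(* The real supremum is only meaningful for u in Lam. *)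
definition Deltas :: "(nat \<Rightarrow> real) \<Rightarrow> nat set" where
  "Deltas u = {k. Max (u ` {0..k}) > (SUP j\<in>{k<..}. u j)}"

(* Only meaningful when Deltas u is nonempty; for u in Lam this is equivalent to Rs u being
   nonempty. *)
definition Ks :: "(nat \<Rightarrow> real) \<Rightarrow> nat" where
  "Ks u = Inf (Deltas u)"

definition Omega01 :: "(real \<Rightarrow> real) set" where
  "Omega01 = {f. strict_mono_on {0..1} f \<and> continuous_on {0..1} f}"

definition inv01 :: "(real \<Rightarrow> real) \<Rightarrow> real \<Rightarrow> real" where
  "inv01 f = the_inv_into {0..1} f"

type_synonym fpair_seq = "(nat \<Rightarrow> real \<Rightarrow> real) \<times> (nat \<Rightarrow> real)"

definition Gam :: "(nat \<Rightarrow> real) \<Rightarrow> fpair_seq set" where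
  "Gam u = {(h, \<beta>). (\<forall>k. h k \<in> Omega01) \<and> (\<forall>k. \<beta> k \<in> {0<..<1}) \<and>
     (\<forall>k. u k \<le> h k (\<beta> k ^ k))}"

definition pair_le :: "(real \<Rightarrow> real) \<times> real \<Rightarrow> (real \<Rightarrow> real) \<times> real \<Rightarrow> bool" where
  "pair_le p q \<longleftrightarrow> (\<forall>x\<in>{0..1}. fst p x \<le> fst q x) \<and> snd p \<le> snd q"

definition dec_from :: "fpair_seq \<Rightarrow> nat \<Rightarrow> bool" where
  "dec_from hb N \<longleftrightarrow>
     (\<forall>n\<ge>N. pair_le (fst hb (Suc n), snd hb (Suc n)) (fst hb n, snd hb n))"

definition Gam_dec :: "(nat \<Rightarrow> real) \<Rightarrow> fpair_seq set" where
  "Gam_dec u = {hb \<in> Gam u. \<exists>N. dec_from hb N}"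

definition m_idx :: "fpair_seq \<Rightarrow> nat" where
  "m_idx hb = (LEAST N. dec_from hb N)"

definition cst_from :: "fpair_seq \<Rightarrow> nat \<Rightarrow> bool" where
  "cst_from hb N \<longleftrightarrow> (\<forall>n\<ge>N. (fst hb n, snd hb n) = (fst hb N, snd hb N))"

definition Gam_cst :: "(nat \<Rightarrow> real) \<Rightarrow> fpair_seq set" where
  "Gam_cst u = {hb \<in> Gam u. \<exists>N. cst_from hb N}"

definition c_idx :: "fpair_seq \<Rightarrow> nat" where
  "c_idx hb = (LEAST N. cst_from hb N)"

definition Sset :: "(nat \<Rightarrow> real) \<Rightarrow> (nat \<Rightarrow> real \<Rightarrow> real) \<Rightarrow> nat set" where
  "Sset u h = {k. u k > h k 0}"

definition usefully_decreasing ::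
  "(nat \<Rightarrow> real) \<Rightarrow> (nat \<Rightarrow> real \<Rightarrow> real) \<Rightarrow> (nat \<Rightarrow> real) \<Rightarrow> bool" where
  "usefully_decreasing u h \<beta> \<longleftrightarrow>
     (h, \<beta>) \<in> Gam_dec u \<and> Sset u h \<inter> {m_idx (h, \<beta>)..} \<noteq> {}"

definition FF ::
  "(nat \<Rightarrow> real) \<Rightarrow> nat \<Rightarrow> (nat \<Rightarrow> real \<Rightarrow> real) \<Rightarrow> (nat \<Rightarrow> real) \<Rightarrow> ereal" where
  "FF u k h \<beta> =
     (if (h, \<beta>) \<in> Gam u \<and> u k > h k 0
      then ereal (ln (inv01 (h k) (u k)) / ln (\<beta> k))
      else \<infinity>)"

(* The floor of a finite extended real; FF u k h \<beta> is finite for (h, \<beta>) in Gam u and k in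
   Sset u h. *)
definition floor_FF ::
  "(nat \<Rightarrow> real) \<Rightarrow> nat \<Rightarrow> (nat \<Rightarrow> real \<Rightarrow> real) \<Rightarrow> (nat \<Rightarrow> real) \<Rightarrow> int" where
  "floor_FF u k h \<beta> = \<lfloor>real_of_ereal (FF u k h \<beta>)\<rfloor>"

end

theory Submission
  imports Defs
begin

text \<open>
  If $k \ge m(h,\beta)$ and $u_k > h_k(0)$, put $x = h_k^{-1}(u_k) \in (0, \beta_k^k]$. For
  $n \ge k$ monotonicity gives $u_n \le h_n(\beta_n^n) \le h_k(\beta_k^n)$, and this is less than
  $h_k(x) = u_k$ once $\beta_k^n < x$, that is, once $n > \ln x / \ln \beta_k$. So no term beyond
  the floor of the upper bound functional at $k$ can be maximal, while $k$ itself is at most that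
  floor. In the constant case $h_k(0)$ does not depend on $k$, so $u_k > h_k(0)$ holds at $k = K^s_u$
  because minimality of $K^s_u$ forces $u_k$ to be the overall maximum there.
\<close>

lemma Omega01_mono:
  assumes "f \<in> Omega01" "x \<in> {0..1}" "y \<in> {0..1}" "x \<le> y"
  shows "f x \<le> f y"
  using assms strict_mono_onD[of "{0..1}" f x y] unfolding Omega01_def
  by (cases "x = y") auto

text \<open>The intermediate value theorem is applied on \<open>{0..b}\<close> rather than
  \<open>{0..1}\<close>, which places the preimage below \<open>b\<close>; injectivity identifies it
  with \<open>inv01 f y\<close>. The strict bound \<open>f 0 < y\<close> excludes the preimage 0, so
  its logarithm can be used later.\<close>

lemma inv01_bounds:
  assumes f: "f \<in> Omega01" and b: "b \<in> {0..1}" and y: "f 0 < y" "y \<le> f b"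
  shows "inv01 f y \<in> {0<..b}" and "f (inv01 f y) = y"
proof -
  have "continuous_on {0..b} f"
    using f b by (auto simp: Omega01_def intro: continuous_on_subset)
  then obtain x where x: "0 \<le> x" "x \<le> b" "f x = y"
    using IVT'[of f 0 y b] b y by auto
  have "inj_on f {0..1}"
    using f by (auto simp: Omega01_def intro: strict_mono_on_imp_inj_on)
  then have "inv01 f y = x"
    unfolding inv01_def using x b by (intro the_inv_into_f_eq) auto
  moreover have "x \<noteq> 0" using x y by auto
  ultimately show "inv01 f y \<in> {0<..b}" and "f (inv01 f y) = y"
    using x by auto
qed

lemma dec_from_le:
  assumes "dec_from (h, \<beta>) N" "N \<le> k" "k \<le> n"
  shows "(\<forall>x\<in>{0..1}. h n x \<le> h k x) \<and> \<beta> n \<le> \<beta> k"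
  using assms(3)
proof (induction n rule: dec_induct)
  case (step n)
  then have "pair_le (h (Suc n), \<beta> (Suc n)) (h n, \<beta> n)"
    using assms by (auto simp: dec_from_def)
  with step.IH show ?case by (auto simp: pair_le_def intro: order_trans)
qed simp

lemma dec_from_m_idx:
  assumes "hb \<in> Gam_dec u"
  shows "dec_from hb (m_idx hb)"
  using assms unfolding Gam_dec_def m_idx_def by (auto intro: LeastI)

lemma cst_from_c_idx:
  assumes "hb \<in> Gam_cst u"
  shows "cst_from hb (c_idx hb)"
  using assms unfolding Gam_cst_def c_idx_def by (auto intro: LeastI)

lemma real_FF:
  assumes "(h, \<beta>) \<in> Gam u" "k \<in> Sset u h"
  shows "real_of_ereal (FF u k h \<beta>) = ln (inv01 (h k) (u k)) / ln (\<beta> k)"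
    and "FF u k h \<beta> \<noteq> \<infinity>"
  using assms by (auto simp: FF_def Sset_def)

lemma GamD:
  assumes "(h, \<beta>) \<in> Gam u"
  shows "h k \<in> Omega01" "0 < \<beta> k" "\<beta> k < 1" "\<beta> k ^ n \<in> {0..1}" "u k \<le> h k (\<beta> k ^ k)"
proof -
  show \<beta>: "0 < \<beta> k" "\<beta> k < 1" and "h k \<in> Omega01" "u k \<le> h k (\<beta> k ^ k)"
    using assms by (auto simp: Gam_def)
  from \<beta> show "\<beta> k ^ n \<in> {0..1}" by (simp add: power_le_one)
qed

lemma inv01_Gam:
  assumes "(h, \<beta>) \<in> Gam u" "k \<in> Sset u h"
  shows "inv01 (h k) (u k) \<in> {0<..\<beta> k ^ k}" and "h k (inv01 (h k) (u k)) = u k"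
  using inv01_bounds[OF GamD(1,4)[OF assms(1)] _ GamD(5)[OF assms(1)]] assms(2)
  by (auto simp: Sset_def)

text \<open>Take logarithms in \<open>inv01 (h k) (u k) \<le> \<beta> k ^ k\<close> and divide by
  the negative number \<open>ln (\<beta> k)\<close>. Thus \<open>k\<close> itself always lies in the
  segment to be searched.\<close>

lemma index_le_floor_FF:
  assumes "(h, \<beta>) \<in> Gam u" "k \<in> Sset u h"
  shows "int k \<le> floor_FF u k h \<beta>"
proof -
  note \<beta> = GamD(2,3)[OF assms(1), of k]
  have "ln (inv01 (h k) (u k)) \<le> ln (\<beta> k ^ k)"
    using inv01_Gam(1)[OF assms] \<beta> by simp
  also have "\<dots> = real k * ln (\<beta> k)"
    using \<beta> by (simp add: ln_realpow)
  finally have "real k \<le> ln (inv01 (h k) (u k)) / ln (\<beta> k)"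
    using \<beta> by (simp add: neg_le_divide_eq)
  then show ?thesis
    by (simp add: floor_FF_def real_FF(1)[OF assms] le_floor_iff)
qed

lemma less_beyond_floor_FF:
  assumes G: "(h, \<beta>) \<in> Gam u" and dec: "dec_from (h, \<beta>) N" "N \<le> k"
    and k: "k \<in> Sset u h" and n: "floor_FF u k h \<beta> < int n"
  shows "u n < u k"
proof -
  define x where "x = inv01 (h k) (u k)"
  note \<beta> = GamD(2,3)[OF G, of k]
  have x: "0 < x" "x \<le> \<beta> k ^ k" "h k x = u k"
    using inv01_Gam[OF G k] by (auto simp: x_def)
  have x1: "x \<le> 1" using x(2) GamD(4)[OF G, of k k] by simp
  have "k \<le> n" using index_le_floor_FF[OF G k] n by simp
  then have le: "\<forall>y\<in>{0..1}. h n y \<le> h k y" "\<beta> n \<le> \<beta> k"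
    using dec_from_le[OF dec] by auto
  have "ln x / ln (\<beta> k) < real n"
    using n by (simp add: floor_FF_def real_FF(1)[OF G k] floor_less_iff x_def)
  \<comment> \<open>Clearing the negative denominator \<open>ln (\<beta> k)\<close> reverses the
    inequality.\<close>
  then have "ln (\<beta> k ^ n) < ln x"
    using \<beta> by (simp add: neg_divide_less_eq ln_realpow)
  then have lt: "\<beta> k ^ n < x" using x \<beta> by simp
  \<comment> \<open>From here the function is replaced first (\<open>h n\<close> by
    \<open>h k\<close>), then the base (\<open>\<beta> n\<close> by \<open>\<beta> k\<close>);
    strictness enters only in the last comparison.\<close>
  have "u n \<le> h n (\<beta> n ^ n)" by (rule GamD(5)[OF G])
  also have "\<dots> \<le> h k (\<beta> n ^ n)" using le GamD(4)[OF G] by blast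
  also have "\<dots> \<le> h k (\<beta> k ^ n)"
    by (rule Omega01_mono[OF GamD(1,4,4)[OF G]])
      (use GamD(2)[OF G, of n] le(2) in \<open>simp add: power_mono\<close>)
  also have "\<dots> < h k x"
    using GamD(1)[OF G, of k] GamD(4)[OF G, of k n] lt x(1) x1
    unfolding Omega01_def by (intro strict_mono_onD[of "{0..1}" "h k"]) auto
  finally show ?thesis using x by simp
qed

text \<open>The segment is finite and contains \<open>k\<close>, and the value at \<open>k\<close>
  dominates everything beyond it, so the maximum over the segment is global.\<close>

lemma is_maximum_initial_segment:
  fixes u :: "nat \<Rightarrow> 'a::linorder"
  assumes k: "int k \<le> M" and beyond: "\<And>n. M < int n \<Longrightarrow> u n \<le> u k"
  shows "\<exists>x. is_maximum (range u) x \<and> is_maximum {u n | n. int n \<le> M} x"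
proof -
  let ?A = "u ` {..nat M}"
  have eq: "{u n | n. int n \<le> M} = ?A" using k by (auto simp: le_nat_iff)
  have in_A: "Max ?A \<in> ?A" by (intro Max_in) auto
  have "u n \<le> Max ?A" for n
  proof (cases "int n \<le> M")
    case True
    then show ?thesis by (intro Max_ge) (auto simp: le_nat_iff)
  next
    case False
    then have "u n \<le> u k" using beyond by simp
    also have "\<dots> \<le> Max ?A" using k by (intro Max_ge) (auto simp: le_nat_iff)
    finally show ?thesis .
  qed
  with in_A show ?thesis
    unfolding eq is_maximum_def by (intro exI[of _ "Max ?A"]) blast
qed

lemma Lam_bdd_above:
  assumes "u \<in> Lam"
  shows "bdd_above (u ` A)"
  using assms by (auto simp: Lam_def intro: bdd_above_mono)

lemma Deltas_nonempty:
  assumes "Rs u \<noteq> {}"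
  shows "Deltas u \<noteq> {}"
proof -
  obtain k where "limsup (\<lambda>n. ereal (u n)) < ereal (u k)"
    using assms by (auto simp: Rs_def)
  \<comment> \<open>The intermediate real \<open>c\<close> keeps the inequality strict after passing
    to the supremum of a tail, which is only known to be at most \<open>c\<close>.\<close>
  then obtain c where c: "limsup (\<lambda>n. ereal (u n)) < ereal c" "c < u k"
    using ereal_dense2 by force
  from Limsup_lessD[OF c(1)] obtain N where N: "\<And>n. n \<ge> N \<Longrightarrow> u n < c"
    by (auto simp: eventually_sequentially)
  have "(SUP j\<in>{max N k<..}. u j) \<le> c"
    using N by (intro cSUP_least) (auto intro: less_imp_le)
  also note c(2)
  also have "u k \<le> Max (u ` {0..max N k})" by (intro Max_ge) auto
  finally show ?thesis by (auto simp: Deltas_def)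
qed

text \<open>Membership of \<open>Ks u\<close> in \<open>Deltas u\<close> bounds the tail by the
  maximum up to \<open>Ks u\<close>; minimality shows that this maximum is attained at
  \<open>Ks u\<close> itself.\<close>

lemma le_at_Ks:
  assumes u: "u \<in> Lam" and R: "Rs u \<noteq> {}"
  shows "u n \<le> u (Ks u)"
proof -
  define K where "K = Ks u"
  have "K \<in> Deltas u"
    unfolding K_def Ks_def using Deltas_nonempty[OF R] by (rule Inf_nat_def1)
  then have max: "(SUP j\<in>{K<..}. u j) < Max (u ` {0..K})" by (simp add: Deltas_def)
  have tail: "u j \<le> (SUP j\<in>{K<..}. u j)" if "K < j" for j
    using that by (intro cSUP_upper Lam_bdd_above[OF u]) simp
  have init: "Max (u ` {0..K}) = u K"
  proof (cases K)
    case (Suc i)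
    have "i \<notin> Deltas u"
      using Suc not_less_Least[of i "\<lambda>k. k \<in> Deltas u"]
      by (auto simp: K_def Ks_def Inf_nat_def)
    then have "Max (u ` {0..i}) \<le> (SUP j\<in>{i<..}. u j)" 
      by (simp add: Deltas_def not_less del: Max_le_iff)
    also have "{i<..} = insert K {K<..}" using Suc by auto
    also have "(SUP j\<in>insert K {K<..}. u j) = max (u K) (SUP j\<in>{K<..}. u j)"
      by (subst image_insert, subst cSup_insert)
        (auto intro: Lam_bdd_above[OF u] simp: sup_max)
    finally have *: "Max (u ` {0..i}) \<le> max (u K) (SUP j\<in>{K<..}. u j)" .
    have "Max (u ` {0..K}) = max (u K) (Max (u ` {0..i}))"
      using Suc by (simp add: atLeast0_atMost_Suc)
    \<comment> \<open>If the maximum up to \<open>i\<close> exceeded \<open>u K\<close>, it would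
      equal the maximum up to \<open>K\<close>, yet by \<open>*\<close> be at most the supremum past
      \<open>K\<close>, contradicting \<open>max\<close>.\<close>
    with * max show ?thesis by linarith
  qed simp
  show ?thesis
  proof (cases "n \<le> K")
    case True
    then have "u n \<le> Max (u ` {0..K})" by (intro Max_ge) auto
    with init show ?thesis by (simp add: K_def)
  next
    case False
    with tail[of n] max init show ?thesis by (simp add: K_def)
  qed
qed

text \<open>Shifting by a lower bound \<open>b\<close> makes all elements nonnegative, so
  \<open>nat\<close> loses nothing and the well-ordering of the naturals applies.\<close>

lemma ex_is_minimum_int:
  fixes A :: "int set"
  assumes "A \<noteq> {}" "bdd_below A"
  shows "\<exists>M. is_minimum A M"
proof -
  obtain b a where b: "\<And>x. x \<in> A \<Longrightarrow> b \<le> x" and "a \<in> A"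
    using assms by (auto simp: bdd_below_def)
  then obtain M where M: "M \<in> A" "\<And>x. x \<in> A \<Longrightarrow> nat (M - b) \<le> nat (x - b)"
    using ex_has_least_nat[of "\<lambda>x. x \<in> A" a "\<lambda>x. nat (x - b)"] by auto
  have "M \<le> x" if "x \<in> A" for x
    using M(2)[OF that] b[OF that] by linarith
  with M(1) show ?thesis by (auto simp: is_minimum_def)
qed

theorem theorem5:
  fixes u :: "nat \<Rightarrow> real"
    and h :: "nat \<Rightarrow> real \<Rightarrow> real"
    and \<beta> :: "nat \<Rightarrow> real"
  assumes "u \<in> Lam"
    and "Rs u \<noteq> {}"
    and "(h, \<beta>) \<in> Gam_dec u"
    and "usefully_decreasing u h \<beta>"
  shows "(\<exists>M x. is_minimum {floor_FF u k h \<beta> | k. k \<in> Sset u h \<inter> {m_idx (h, \<beta>)..}} M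
            \<and> int (m_idx (h, \<beta>)) \<le> M
            \<and> is_maximum (range u) x
            \<and> is_maximum {u n | n. int n \<le> M} x)
       \<and> ((h, \<beta>) \<in> Gam_cst u \<and> c_idx (h, \<beta>) = 0 \<longrightarrow>
            FF u (Ks u) h \<beta> \<noteq> \<infinity>
            \<and> (\<exists>x. is_maximum (range u) x
                 \<and> is_maximum {u n | n. int n \<le> floor_FF u (Ks u) h \<beta>} x))"
proof (intro conjI impI)
  let ?m = "m_idx (h, \<beta>)"
  let ?A = "{floor_FF u k h \<beta> | k. k \<in> Sset u h \<inter> {?m..}}"
  have G: "(h, \<beta>) \<in> Gam u" using assms(3) by (simp add: Gam_dec_def)
  have dec: "dec_from (h, \<beta>) ?m" using assms(3) by (rule dec_from_m_idx)
  have S: "Sset u h \<inter> {?m..} \<noteq> {}" using assms(4) by (simp add: usefully_decreasing_def)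
  \<comment> \<open>Each floor is at least its own index, which is at least
    \<open>?m\<close>.\<close>
  have "int ?m \<le> a" if "a \<in> ?A" for a
    using that index_le_floor_FF[OF G] by force
  then have "bdd_below ?A" by (rule bdd_belowI)
  moreover have "?A \<noteq> {}" using S by auto
  ultimately obtain M where M: "is_minimum ?A M" using ex_is_minimum_int[of ?A] by auto
  then obtain k where k: "k \<in> Sset u h" "?m \<le> k" "M = floor_FF u k h \<beta>"
    by (auto simp: is_minimum_def)
  have kM: "int k \<le> M" using index_le_floor_FF[OF G k(1)] k(3) by simp
  have "u n \<le> u k" if "M < int n" for n
    using less_beyond_floor_FF[OF G dec k(2,1)] that k(3) by (simp add: less_imp_le)
  then obtain x where "is_maximum (range u) x" "is_maximum {u n | n. int n \<le> M} x"
    using is_maximum_initial_segment[OF kM] by blast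
  moreover have "int ?m \<le> M" using kM k(2) by simp
  ultimately show "\<exists>M x. is_minimum ?A M \<and> int ?m \<le> M \<and> is_maximum (range u) x
      \<and> is_maximum {u n | n. int n \<le> M} x"
    using M by blast

  assume cst: "(h, \<beta>) \<in> Gam_cst u \<and> c_idx (h, \<beta>) = 0"
  then have h: "h n = h 0" for n
    using cst_from_c_idx[of "(h, \<beta>)" u] by (auto simp: cst_from_def)
  \<comment> \<open>The index \<open>k\<close> from the first part witnesses that \<open>u\<close>
    exceeds the common value \<open>h 0 0\<close>, hence so does its largest value
    \<open>u (Ks u)\<close>.\<close>
  have "h 0 0 < u k" using k(1) h[of k] by (simp add: Sset_def)
  also have "\<dots> \<le> u (Ks u)" using assms(1,2) by (rule le_at_Ks)
  finally have K: "Ks u \<in> Sset u h" using h[of "Ks u"] by (simp add: Sset_def)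
  show "FF u (Ks u) h \<beta> \<noteq> \<infinity>" by (rule real_FF(2)[OF G K])
  \<comment> \<open>As \<open>u (Ks u)\<close> is already the overall maximum, it suffices that the
    segment reaches \<open>Ks u\<close>.\<close>
  show "\<exists>x. is_maximum (range u) x \<and> is_maximum {u n | n. int n \<le> floor_FF u (Ks u) h \<beta>} x"
    using index_le_floor_FF[OF G K] le_at_Ks[OF assms(1,2)] by (rule is_maximum_initial_segment)
qed

end
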